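(* Let $$\mathcal A=\delta\big(\tfrac{x_1}{x_3},\mu_1\big)\,\delta\big(\tfrac{x_2}{x_4},\mu_2\big)\,\delta\big(\tfrac{x_1}{x_4},h\big).$$ Then $$\mathfrak C_1^{\mu_1/\mu_2}(\mathcal A)=s_1^\mu\,\mathfrak C_3^{\mu_2/\mu_1}(\mathcal A).$$ The analogous identity holds for the reduced operations: $\overline{\mathfrak C}{}_1^{\mu_1/\mu_2}(\mathcal A)=s_1^\mu\,\overline{\mathfrak C}{}_3^{\mu_2/\mu_1}(\mathcal A)$.
   Context: For $\operatorname{Im}\tau>0$, $q=e^{2\pi i\tau}$, put $\theta_\tau(x)=2q^{1/8}\sin(\pi x)\prod_{n\ge1}(1-q^n)(1-q^ne^{2\pi i x})(1-q^ne^{-2\pi i x})$, $F_\tau(x,y)=\frac{\theta_\tau'(0)\theta_\tau(x+y)}{\theta_\tau(x)\theta_\tau(y)}$, and let $\delta=\delta_\tau$ be the meromorphic function on $\mathbb C^*\times\mathbb C^*$ with $\delta(e^{2\pi i x},e^{2\pi i y})=F_\tau(x,y)$. Functions are meromorphic in $x_1,x_2,x_3,x_4,h,\mu_1,\mu_2\in\mathbb C^*$. For a nontrivial Laurent monomial $\nu$ in $\mu_1,\mu_2$, $$\mathfrak C_i^\nu(f)=\delta\big(\tfrac{x_{i+1}}{x_i},\nu\big)f+\delta\big(\tfrac{x_i}{x_{i+1}},h\big)s_if,\qquad \overline{\mathfrak C}{}_i^\nu=\tfrac1{\delta(\nu,h)}\mathfrak C_i^\nu,\qquad i=1,2,3,$$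 where $s_i$ exchanges $x_i$ and $x_{i+1}$ only. $s_1^\mu$ exchanges the variables $\mu_1$ and $\mu_2$ in the whole function (here: in the function $\mathfrak C_3^{\mu_2/\mu_1}(\mathcal A)$, respectively $\overline{\mathfrak C}{}_3^{\mu_2/\mu_1}(\mathcal A)$). *)

theory Defs
  imports "HOL-Analysis.Analysis" "HOL-Combinatorics.Transposition"
begin

definition nome :: "complex \<Rightarrow> complex" where
  "nome \<tau> = exp (2 * of_real pi * \<i> * \<tau>)"

text \<open>The branch of the eighth root of the nome is the one determined by \<open>\<tau>\<close>. The library
  product starts at index 0, so the factor with index \<open>n \<ge> 1\<close> appears with \<open>Suc n\<close>.\<close>

definition theta :: "complex \<Rightarrow> complex \<Rightarrow> complex" where
  "theta \<tau> x = 2 * exp (2 * of_real pi * \<i> * \<tau> / 8) * sin (of_real pi * x) *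
     (\<Prod>n. (1 - nome \<tau> ^ Suc n)
          * (1 - nome \<tau> ^ Suc n * exp (2 * of_real pi * \<i> * x))
          * (1 - nome \<tau> ^ Suc n * exp (- (2 * of_real pi * \<i> * x))))"

definition F :: "complex \<Rightarrow> complex \<Rightarrow> complex \<Rightarrow> complex" where
  "F \<tau> x y = deriv (theta \<tau>) 0 * theta \<tau> (x + y) / (theta \<tau> x * theta \<tau> y)"

text \<open>The choice of logarithm is immaterial because \<open>F\<close> has period 1 in both arguments; see
  lemma \<open>delta_exp\<close>, which is the defining property of \<open>\<delta>\<close>.\<close>

definition delta :: "complex \<Rightarrow> complex \<Rightarrow> complex \<Rightarrow> complex" where
  "delta \<tau> a b = F \<tau> (Ln a / (2 * of_real pi * \<i>)) (Ln b / (2 * of_real pi * \<i>))"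

lemma theta_plus_one: "theta \<tau> (x + 1) = - theta \<tau> x"
proof -
  have s: "sin (of_real pi * (x + 1)) = - sin (of_real pi * x)"
    by (simp add: distrib_left sin_add flip: sin_of_real cos_of_real)
  have e: "exp (2 * of_real pi * \<i> * (x + 1)) = exp (2 * of_real pi * \<i> * x)"
    by (simp add: distrib_left exp_add exp_two_pi_i)
  show ?thesis
    unfolding theta_def exp_minus e s by simp
qed

lemma F_commute: "F \<tau> x y = F \<tau> y x"
  by (simp add: F_def add.commute mult.commute)

lemma F_plus_one: "F \<tau> (x + 1) y = F \<tau> x y"
proof -
  have "theta \<tau> (x + 1 + y) = - theta \<tau> (x + y)"
    using theta_plus_one[of \<tau> "x + y"] by (simp add: algebra_simps)
  then show ?thesis by (simp add: F_def theta_plus_one)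
qed

lemma F_plus_int: "F \<tau> (x + of_int k) y = F \<tau> x y"
proof (induction k rule: int_induct[where k = 0])
  case (step1 i)
  then show ?case using F_plus_one[of \<tau> "x + of_int i" y] by (simp add: algebra_simps)
next
  case (step2 i)
  then show ?case using F_plus_one[of \<tau> "x + of_int (i - 1)" y] by (simp add: algebra_simps)
qed simp

lemma delta_exp: "delta \<tau> (exp (2 * of_real pi * \<i> * x)) (exp (2 * of_real pi * \<i> * y)) = F \<tau> x y"
proof -
  have L: "\<exists>k. Ln (exp (2 * of_real pi * \<i> * z)) / (2 * of_real pi * \<i>) = z + of_int k"
    for z :: complex
  proof -
    have "exp (Ln (exp (2 * of_real pi * \<i> * z))) = exp (2 * of_real pi * \<i> * z)" by simp
    then obtain k :: int where
      "Ln (exp (2 * of_real pi * \<i> * z)) = 2 * of_real pi * \<i> * z + (of_int (2 * k) * of_real pi) * \<i>"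
      unfolding exp_eq by auto
    then have "Ln (exp (2 * of_real pi * \<i> * z)) / (2 * of_real pi * \<i>) = z + of_int k"
      by (simp add: field_simps)
    then show ?thesis ..
  qed
  from L[of x] L[of y] show ?thesis
    unfolding delta_def by (metis F_plus_int F_commute)
qed

text \<open>A point is \<open>(x, h, \<mu>)\<close>. In the index type \<open>4\<close> the numeral \<open>4\<close> equals \<open>0\<close>, so
  \<open>1, 2, 3, 4\<close> are its four distinct elements, and \<open>3 + 1 = 4\<close>;
  likewise \<open>1, 2\<close> are the two elements of the type \<open>2\<close>.\<close>

type_synonym point = "(complex ^ 4) \<times> complex \<times> (complex ^ 2)"

definition torus :: "point set" where
  "torus = {(x, h, \<mu>). (\<forall>i. x $ i \<noteq> 0) \<and> h \<noteq> 0 \<and> (\<forall>j. \<mu> $ j \<noteq> 0)}"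

text \<open>A meromorphic function on the torus is represented by a total function whose values on its
  polar set (given by the convention \<open>z / 0 = 0\<close>) carry no meaning. Two meromorphic functions
  are equal iff they agree on a dense open subset.\<close>

definition mero_eq :: "(point \<Rightarrow> complex) \<Rightarrow> (point \<Rightarrow> complex) \<Rightarrow> bool" where
  "mero_eq f g \<longleftrightarrow>
     (\<exists>U. open U \<and> U \<subseteq> torus \<and> torus \<subseteq> closure U \<and> (\<forall>p\<in>U. f p = g p))"

definition swap_x :: "4 \<Rightarrow> (point \<Rightarrow> complex) \<Rightarrow> point \<Rightarrow> complex" where
  "swap_x i f = (\<lambda>(x, h, \<mu>). f (\<chi> j. x $ Transposition.transpose i (i + 1) j, h, \<mu>))"

definition swap_mu :: "(point \<Rightarrow> complex) \<Rightarrow> point \<Rightarrow> complex" where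
  "swap_mu f = (\<lambda>(x, h, \<mu>). f (x, h, \<chi> j. \<mu> $ Transposition.transpose 1 2 j))"

text \<open>The parameter \<open>\<nu>\<close> stands for a nontrivial Laurent monomial, given as a function of
  \<open>\<mu>\<close>, so that \<^const>\<open>swap_mu\<close> also acts on it. The index \<open>i\<close> is meant to be 1, 2 or 3.\<close>

definition C_op :: "complex \<Rightarrow> 4 \<Rightarrow> (complex ^ 2 \<Rightarrow> complex) \<Rightarrow> (point \<Rightarrow> complex) \<Rightarrow> point \<Rightarrow> complex"
  where
  "C_op \<tau> i \<nu> f = (\<lambda>(x, h, \<mu>).
     delta \<tau> (x $ (i + 1) / x $ i) (\<nu> \<mu>) * f (x, h, \<mu>)
     + delta \<tau> (x $ i / x $ (i + 1)) h * swap_x i f (x, h, \<mu>))"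

definition C_red :: "complex \<Rightarrow> 4 \<Rightarrow> (complex ^ 2 \<Rightarrow> complex) \<Rightarrow> (point \<Rightarrow> complex) \<Rightarrow> point \<Rightarrow> complex"
  where
  "C_red \<tau> i \<nu> f = (\<lambda>(x, h, \<mu>). 1 / delta \<tau> (\<nu> \<mu>) h * C_op \<tau> i \<nu> f (x, h, \<mu>))"

definition A_fun :: "complex \<Rightarrow> point \<Rightarrow> complex" where
  "A_fun \<tau> = (\<lambda>(x, h, \<mu>).
     delta \<tau> (x $ 1 / x $ 3) (\<mu> $ 1) * delta \<tau> (x $ 2 / x $ 4) (\<mu> $ 2) * delta \<tau> (x $ 1 / x $ 4) h)"

end

theory Submission
  imports Defs "HOL-Complex_Analysis.Conformal_Mappings"
begin

text \<open>
  On the torus coordinates \<open>x\<^sub>i = e(\<xi>\<^sub>i)\<close>, \<open>h = e(\<eta>)\<close>, \<open>\<mu>\<^sub>j = e(\<zeta>\<^sub>j)\<close> the claim is an identity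
  between four products of theta quotients. Grouping the two terms containing
  \<open>\<zeta>\<^sub>1 - \<zeta>\<^sub>2\<close> and the other two, Weierstrass' three-term identity for theta turns each group
  into a single product, and these cancel thanks to the common factor
  \<open>\<theta>(\<xi>\<^sub>2 + \<xi>\<^sub>3 - \<xi>\<^sub>1 - \<xi>\<^sub>4)\<close>. The three-term identity is proved by Liouville's theorem: as functions
  of \<open>x\<close> its terms have the quasi-periods of \<open>\<theta>(x - w) \<theta>(x + w)\<close>, whose simple zeros
  are zeros of the sum. The reduced operations differ only by the factor \<open>1/\<delta>(\<mu>\<^sub>1/\<mu>\<^sub>2, h)\<close>,
  which is the same on both sides.\<close>

section \<open>Infinite \<open>q\<close>-Pochhammer products\<close>

text \<open>The symbol (v; q)_\<infinity>. With \<open>v\<close> kept separate, shifting theta by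
  \<tau> multiplies or divides this argument by \<open>q\<close>.\<close>

definition qpoch :: "complex \<Rightarrow> complex \<Rightarrow> complex" where
  "qpoch q v = (\<Prod>n. 1 - v * q ^ n)"

context
  fixes q :: complex
  assumes q: "norm q < 1"
begin

lemma convergent_prod_qpoch: "convergent_prod (\<lambda>n. 1 - v * q ^ n)"
proof -
  have "summable (\<lambda>n. norm v * norm q ^ n)"
    using q by (intro summable_mult summable_geometric) auto
  then have "abs_convergent_prod (\<lambda>n. 1 - v * q ^ n)"
    by (intro summable_imp_abs_convergent_prod) (simp add: norm_mult norm_power)
  then show ?thesis by (rule abs_convergent_prod_imp_convergent_prod)
qed

text \<open>Comparing limits of partial products also covers \<open>v = 1\<close>, where the factor
  split off vanishes.\<close>

lemma qpoch_rec: "qpoch q v = (1 - v) * qpoch q (v * q)"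
proof -
  have "(\<lambda>n. \<Prod>i\<le>Suc n. 1 - v * q ^ i) \<longlonglongrightarrow> qpoch q v"
    using convergent_prod_LIMSEQ[OF convergent_prod_qpoch] unfolding qpoch_def
    by (rule LIMSEQ_Suc)
  moreover have "(\<lambda>n. (1 - v) * (\<Prod>i\<le>n. 1 - v * q * q ^ i)) \<longlonglongrightarrow> (1 - v) * qpoch q (v * q)"
    unfolding qpoch_def by (intro tendsto_intros convergent_prod_LIMSEQ convergent_prod_qpoch)
  moreover have "(\<Prod>i\<le>Suc n. 1 - v * q ^ i) = (1 - v) * (\<Prod>i\<le>n. 1 - v * q * q ^ i)" for n
    by (subst prod.atMost_Suc_shift) (simp add: mult.assoc)
  ultimately show ?thesis by (metis (no_types, lifting) LIMSEQ_unique ext)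
qed

lemma qpoch_nonzero: "norm v < 1 \<Longrightarrow> qpoch q v \<noteq> 0"
  unfolding qpoch_def
proof (rule prodinf_nonzero[OF convergent_prod_qpoch])
  fix i assume v: "norm v < 1"
  have "norm (v * q ^ i) \<le> norm v"
    using q by (simp add: norm_mult norm_power mult_left_le power_le_one)
  with v show "1 - v * q ^ i \<noteq> 0" by auto
qed

text \<open>On the unit ball around \<open>x\<close> the bound |v| \<le> |x| + 1 gives a geometric
  majorant, so the function is a locally uniform limit of polynomials in \<open>v\<close>.\<close>

lemma holomorphic_qpoch: "qpoch q holomorphic_on UNIV"
proof -
  have "\<exists>d>0. cball x d \<subseteq> UNIV \<and> uniform_limit (cball x d) (\<lambda>n v. \<Prod>i<n. 1 - v * q ^ i) (qpoch q) sequentially" for x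
  proof -
    have "uniformly_convergent_on (cball x 1) (\<lambda>N v. \<Sum>n<N. norm ((1 - v * q ^ n) - 1))"
    proof (rule Weierstrass_m_test'_ev)
      show "summable (\<lambda>n. (norm x + 1) * norm q ^ n)"
        using q by (intro summable_mult summable_geometric) auto
      have "norm (norm ((1 - v * q ^ n) - 1)) \<le> (norm x + 1) * norm q ^ n" if "v \<in> cball x 1" for n v
      proof -
        have "norm v \<le> norm x + 1"
          using that norm_triangle_sub[of v x] by (auto simp: dist_norm norm_minus_commute)
        then show ?thesis by (simp add: norm_mult norm_power mult_right_mono)
      qed
      then show "\<forall>\<^sub>F n in sequentially. \<forall>v\<in>cball x 1. norm (norm ((1 - v * q ^ n) - 1)) \<le> (norm x + 1) * norm q ^ n"
        by simp
    qed
    then have "uniformly_convergent_on (cball x 1) (\<lambda>N v. \<Prod>n<N. 1 - v * q ^ n)"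
      by (intro uniformly_convergent_on_prod') (auto intro!: continuous_intros)
    then obtain l where l: "uniform_limit (cball x 1) (\<lambda>N v. \<Prod>n<N. 1 - v * q ^ n) l sequentially"
      by (auto simp: uniformly_convergent_on_def)
    have "l v = qpoch q v" if "v \<in> cball x 1" for v
    proof (rule LIMSEQ_unique)
      show "(\<lambda>N. \<Prod>n<N. 1 - v * q ^ n) \<longlonglongrightarrow> l v"
        using tendsto_uniform_limitI[OF l that] .
      show "(\<lambda>N. \<Prod>n<N. 1 - v * q ^ n) \<longlonglongrightarrow> qpoch q v"
        using convergent_prod_LIMSEQ[OF convergent_prod_qpoch[of v]]
        unfolding qpoch_def LIMSEQ_lessThan_iff_atMost .
    qed
    with l have "uniform_limit (cball x 1) (\<lambda>N v. \<Prod>n<N. 1 - v * q ^ n) (qpoch q) sequentially"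
      by (metis (no_types, lifting) uniform_limit_cong')
    then show ?thesis by (intro exI[of _ 1]) auto
  qed
  then show ?thesis
    by (rule holomorphic_uniform_sequence[OF open_UNIV, rotated]) (intro holomorphic_intros)
qed

lemma holomorphic_on_qpoch: "f holomorphic_on A \<Longrightarrow> (\<lambda>x. qpoch q (f x)) holomorphic_on A"
  using holomorphic_on_compose_gen[OF _ holomorphic_qpoch, of f A] by (simp add: o_def)

end

section \<open>The theta function\<close>

abbreviation (input) ex :: "complex \<Rightarrow> complex" where
  "ex x \<equiv> exp (2 * of_real pi * \<i> * x)"

text \<open>The sine is odd, and the two exponential factors of the product trade places.\<close>

lemma theta_minus: "theta \<tau> (- x) = - theta \<tau> x"
  unfolding theta_def
  by (simp add: mult.assoc mult.commute mult.left_commute)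

lemma norm_nome: "norm (nome \<tau>) = exp (- 2 * pi * Im \<tau>)"
  by (simp add: nome_def)

context
  fixes \<tau> :: complex
  assumes tau: "Im \<tau> > 0"
begin

lemma norm_nome_less_1: "norm (nome \<tau>) < 1"
  using tau by (simp add: norm_nome)

lemma theta_eq_qpoch:
  "theta \<tau> x = 2 * exp (2 * of_real pi * \<i> * \<tau> / 8) * sin (of_real pi * x) *
     (qpoch (nome \<tau>) (nome \<tau>) * qpoch (nome \<tau>) (nome \<tau> * ex x) * qpoch (nome \<tau>) (nome \<tau> * ex (- x)))"
proof -
  note c = convergent_prod_qpoch[OF norm_nome_less_1]
  have "qpoch (nome \<tau>) (nome \<tau>) * qpoch (nome \<tau>) (nome \<tau> * ex x) * qpoch (nome \<tau>) (nome \<tau> * ex (- x)) =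
     (\<Prod>n. (1 - nome \<tau> * nome \<tau> ^ n) * (1 - nome \<tau> * ex x * nome \<tau> ^ n) * (1 - nome \<tau> * ex (- x) * nome \<tau> ^ n))"
    unfolding qpoch_def by (simp only: prodinf_mult c convergent_prod_mult)
  then show ?thesis unfolding theta_def by (simp add: mult_ac)
qed

lemma holomorphic_theta: "theta \<tau> holomorphic_on UNIV"
  unfolding theta_eq_qpoch[abs_def]
  by (intro holomorphic_intros holomorphic_on_qpoch norm_nome_less_1)

lemma holomorphic_on_theta:
  "f holomorphic_on A \<Longrightarrow> (\<lambda>x. theta \<tau> (f x)) holomorphic_on A"
  using holomorphic_on_compose_gen[OF _ holomorphic_theta, of f A] by (simp add: o_def)

text \<open>The shift moves each of the two exponential products by one index; the boundary factors
  from \<open>qpoch_rec\<close> combine with the sine into the multiplier.\<close>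

lemma theta_plus_tau: "theta \<tau> (x + \<tau>) = - exp (- (of_real pi * \<i> * \<tau>)) * ex (- x) * theta \<tau> x"
proof -
  note rec = qpoch_rec[OF norm_nome_less_1]
  define q where "q = nome \<tau>"
  \<comment> \<open>The sine involves exp (pi i x), so these half-period exponentials make the
    elementary factors rational in \<open>s\<close> and \<open>t\<close>.\<close>
  define s t where "s = exp (of_real pi * \<i> * x)" and "t = exp (of_real pi * \<i> * \<tau>)"
  have nz: "s \<noteq> 0" "t \<noteq> 0" by (auto simp: s_def t_def)
  have q: "q = t\<^sup>2" "nome \<tau> = t\<^sup>2"
    using exp_double[of "of_real pi * \<i> * \<tau>"] by (simp_all add: q_def nome_def t_def mult.assoc)
  have e: "ex x = s\<^sup>2" "ex (x + \<tau>) = s\<^sup>2 * t\<^sup>2" "ex (- x) = inverse (s\<^sup>2)"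
    "ex (- (x + \<tau>)) = inverse (s\<^sup>2 * t\<^sup>2)" "exp (- (of_real pi * \<i> * \<tau>)) = inverse t"
    by (auto simp: s_def t_def power2_eq_square algebra_simps simp flip: exp_add exp_minus)
  have sn: "sin (of_real pi * x) = \<i> * (inverse s - s) / 2"
    "sin (of_real pi * (x + \<tau>)) = \<i> * (inverse s * inverse t - s * t) / 2"
    by (auto simp: sin_exp_eq s_def t_def field_simps simp flip: exp_add exp_minus)
  have r1: "qpoch q (q * s\<^sup>2) = (1 - t\<^sup>2 * s\<^sup>2) * qpoch q (q * (s\<^sup>2 * t\<^sup>2))"
    using rec[of "q * s\<^sup>2", folded q_def] by (simp add: q(1) mult_ac)
  have r2: "qpoch q (q * inverse (s\<^sup>2 * t\<^sup>2)) = (1 - inverse (s\<^sup>2)) * qpoch q (q * inverse (s\<^sup>2))"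
    using rec[of "q * inverse (s\<^sup>2 * t\<^sup>2)", folded q_def] nz by (simp add: q(1) field_simps)
  \<comment> \<open>What remains once the Pochhammer factors common to both sides are
    removed.\<close>
  have key: "(inverse s * inverse t - s * t) * (1 - inverse (s\<^sup>2))
      = - inverse t * inverse (s\<^sup>2) * (inverse s - s) * (1 - t\<^sup>2 * s\<^sup>2)"
    using nz by (simp add: field_simps power2_eq_square)
  show ?thesis
    unfolding theta_eq_qpoch sn e q_def[symmetric] r1 r2
    using arg_cong[OF key, of "\<lambda>z. z * (\<i> / 2 * 2 * exp (2 * complex_of_real pi * \<i> * \<tau> / 8) *
       qpoch q q * qpoch q (q * (s\<^sup>2 * t\<^sup>2)) * qpoch q (q * inverse (s\<^sup>2)))"]
    by (simp only: mult_ac times_divide_eq_right times_divide_eq_left)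
qed

section \<open>Zeros of theta and their simplicity\<close>

lemma theta_plus_lattice_eq_0_iff:
  "theta \<tau> (x + of_int m + of_int n * \<tau>) = 0 \<longleftrightarrow> theta \<tau> x = 0"
proof -
  have 1: "theta \<tau> (y + of_int m) = 0 \<longleftrightarrow> theta \<tau> y = 0" for y
  proof (induction m rule: int_induct[where k = 0])
    case (step1 i)
    then show ?case using theta_plus_one[of \<tau> "y + of_int i"] by (simp add: algebra_simps)
  next
    case (step2 i)
    then show ?case using theta_plus_one[of \<tau> "y + of_int (i - 1)"] by (simp add: algebra_simps)
  qed simp
  have 2: "theta \<tau> (y + of_int n * \<tau>) = 0 \<longleftrightarrow> theta \<tau> y = 0" for y
  proof (induction n rule: int_induct[where k = 0])
    case (step1 i)
    then show ?case using theta_plus_tau[of "y + of_int i * \<tau>"] by (simp add: algebra_simps)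
  next
    case (step2 i)
    then show ?case using theta_plus_tau[of "y + of_int (i - 1) * \<tau>"] by (simp add: algebra_simps)
  qed simp
  show ?thesis using 1[of x] 2[of "x + of_int m"] by simp
qed

text \<open>A multiple of \<tau> moves the zero into the strip 0 \<le> Im y < Im \<tau>, where the
  infinite products do not vanish and only the sine can.\<close>

lemma theta_eq_0_imp: "theta \<tau> x = 0 \<Longrightarrow> \<exists>m n. x = of_int m + of_int n * \<tau>"
proof -
  assume z: "theta \<tau> x = 0"
  define n where "n = \<lfloor>Im x / Im \<tau>\<rfloor>"
  define y where "y = x - of_int n * \<tau>"
  have y0: "theta \<tau> y = 0"
    using theta_plus_lattice_eq_0_iff[of y 0 n] z by (simp add: y_def)
  have "of_int n \<le> Im x / Im \<tau>" "Im x / Im \<tau> < of_int n + 1"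
    unfolding n_def by linarith+
  then have im: "0 \<le> Im y" "Im y < Im \<tau>"
    using tau by (auto simp: y_def field_simps)
  \<comment> \<open>Since |ex y| = exp (- 2 pi Im y), the two bounds amount to Im \<tau> + Im y > 0
    and Im \<tau> - Im y > 0.\<close>
  have "norm (nome \<tau> * ex y) < 1"
    using mult_pos_pos[OF pi_gt_zero add_pos_nonneg[OF tau im(1)]]
    by (simp add: norm_mult norm_nome distrib_left flip: exp_add)
  moreover have "norm (nome \<tau> * ex (- y)) < 1"
    using im tau by (auto simp: norm_mult norm_nome simp flip: exp_add)
  ultimately have "sin (of_real pi * y) = 0"
    using y0 qpoch_nonzero[OF norm_nome_less_1] norm_nome_less_1
    unfolding theta_eq_qpoch by auto
  then obtain m :: int where "of_real pi * y = of_int m * of_real pi"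
    using sin_eq_0[of "of_real pi * y"] by auto
  then have "y = of_int m" by simp
  then have "x = of_int m + of_int n * \<tau>" by (simp add: y_def algebra_simps)
  then show ?thesis by blast
qed

lemma theta_lattice: "theta \<tau> (of_int m + of_int n * \<tau>) = 0"
  using theta_plus_lattice_eq_0_iff[of 0 m n] by (simp add: theta_def)

text \<open>At 0 only the derivative of the sine survives, and \<open>G 0\<close> is a product of
  Pochhammer values at \<open>nome \<tau>\<close>, inside the unit disc.\<close>

lemma deriv_theta_0: "deriv (theta \<tau>) 0 \<noteq> 0"
proof -
  define G where "G x = qpoch (nome \<tau>) (nome \<tau>) * qpoch (nome \<tau>) (nome \<tau> * ex x) *
    qpoch (nome \<tau>) (nome \<tau> * ex (- x))" for x
  define c where "c = 2 * exp (2 * of_real pi * \<i> * \<tau> / 8)"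
  have "G holomorphic_on UNIV" unfolding G_def
    by (intro holomorphic_intros holomorphic_on_qpoch norm_nome_less_1)
  then have "(G has_field_derivative deriv G 0) (at 0)"
    using holomorphic_derivI by blast
  then have "((\<lambda>x. c * sin (of_real pi * x) * G x) has_field_derivative c * of_real pi * G 0) (at 0)"
    by (auto intro!: derivative_eq_intros)
  moreover have "theta \<tau> = (\<lambda>x. c * sin (of_real pi * x) * G x)"
    by (simp add: fun_eq_iff theta_eq_qpoch c_def G_def)
  ultimately have "deriv (theta \<tau>) 0 = c * of_real pi * G 0" by (simp add: DERIV_imp_deriv)
  moreover have "G 0 \<noteq> 0" using qpoch_nonzero[OF norm_nome_less_1 norm_nome_less_1] by (simp add: G_def)
  ultimately show ?thesis by (simp add: c_def)
qed

lemma theta_has_derivative: "(theta \<tau> has_field_derivative deriv (theta \<tau>) x) (at x)"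
  using holomorphic_derivI[OF holomorphic_theta] by auto

text \<open>Every zero is a lattice point, and there the derivative picks up the same nonzero
  multipliers as theta, so simplicity propagates from 0.\<close>

lemma deriv_theta_nonzero:
  assumes "theta \<tau> x = 0" shows "deriv (theta \<tau>) x \<noteq> 0"
proof -
  have 1: "deriv (theta \<tau>) (y + 1) = - deriv (theta \<tau>) y" for y
  proof -
    have "((\<lambda>z. theta \<tau> (z + 1)) has_field_derivative deriv (theta \<tau>) (y + 1)) (at y)"
      using theta_has_derivative[of "y + 1"] by (simp add: DERIV_shift)
    moreover have "((\<lambda>z. theta \<tau> (z + 1)) has_field_derivative - deriv (theta \<tau>) y) (at y)"
      unfolding theta_plus_one by (intro DERIV_minus theta_has_derivative)
    ultimately show ?thesis by (rule DERIV_unique)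
  qed
  \<comment> \<open>Differentiating the multiplier adds a term with the factor
    \<open>theta \<tau> y\<close>; hence the restriction to zeros.\<close>
  have 2: "deriv (theta \<tau>) (y + \<tau>) = - exp (- (of_real pi * \<i> * \<tau>)) * ex (- y) * deriv (theta \<tau>) y"
    if "theta \<tau> y = 0" for y
  proof -
    have "((\<lambda>z. theta \<tau> (z + \<tau>)) has_field_derivative deriv (theta \<tau>) (y + \<tau>)) (at y)"
      using theta_has_derivative[of "y + \<tau>"] by (simp add: DERIV_shift)
    moreover have "((\<lambda>z. theta \<tau> (z + \<tau>)) has_field_derivative
        - exp (- (of_real pi * \<i> * \<tau>)) * ex (- y) * deriv (theta \<tau>) y) (at y)"
      unfolding theta_plus_tau using that
      by (auto intro!: derivative_eq_intros theta_has_derivative)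
    ultimately show ?thesis by (rule DERIV_unique)
  qed
  have A: "deriv (theta \<tau>) (of_int n * \<tau>) \<noteq> 0" for n
  proof (induction n rule: int_induct[where k = 0])
    case base
    then show ?case by (simp add: deriv_theta_0)
  next
    case (step1 i)
    then show ?case using 2[of "of_int i * \<tau>"] theta_lattice[of 0 i] by (simp add: algebra_simps)
  next
    case (step2 i)
    then show ?case using 2[of "of_int (i - 1) * \<tau>"] theta_lattice[of 0 "i - 1"]
      by (simp add: algebra_simps)
  qed
  have B: "deriv (theta \<tau>) (of_int m + of_int n * \<tau>) \<noteq> 0" for m n
  proof (induction m rule: int_induct[where k = 0])
    case base
    then show ?case using A by simp
  next
    case (step1 i)
    then show ?case using 1[of "of_int i + of_int n * \<tau>"] by (simp add: algebra_simps)
  next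
    case (step2 i)
    then show ?case using 1[of "of_int (i - 1) + of_int n * \<tau>"] by (simp add: algebra_simps)
  qed
  show ?thesis using theta_eq_0_imp[OF assms] B by auto
qed

end

section \<open>Entire functions\<close>

text \<open>Balls are uncountable. This yields the density of generic parameters, complex for the
  three-term identity and real for curves in the torus.\<close>

lemma closure_Compl_countable: "countable S \<Longrightarrow> closure (- S) = (UNIV :: 'a :: euclidean_space set)"
proof -
  assume S: "countable S"
  have "x \<in> closure (- S)" for x
    unfolding closure_approachable
  proof (intro allI impI)
    fix e :: real assume "e > 0"
    then have "ball x e - S \<noteq> {}" using ball_minus_countable_nonempty[OF S] by blast
    then show "\<exists>y\<in>- S. dist y x < e" by (auto simp: dist_commute)
  qed
  then show ?thesis by blast
qed

text \<open>The zeros of \<open>P\<close> are simple, so dividing numerator and denominator by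
  \<open>x - a\<close> removes the singularity at a zero \<open>a\<close>.\<close>

lemma entire_quotient:
  assumes D: "D holomorphic_on UNIV" and P: "P holomorphic_on UNIV"
    and z: "\<And>x. P x = 0 \<Longrightarrow> D x = 0" "\<And>x. P x = 0 \<Longrightarrow> deriv P x \<noteq> 0"
  obtains g where "g holomorphic_on UNIV" "\<And>x. D x = g x * P x"
proof -
  define g where "g x = (if P x = 0 then deriv D x / deriv P x else D x / P x)" for x
  have "\<exists>N. open N \<and> a \<in> N \<and> g holomorphic_on N" for a
  proof (cases "P a = 0")
    case False
    define N where "N = {x. P x \<noteq> 0}"
    have "open N"
      unfolding N_def using holomorphic_on_imp_continuous_on[OF P]
      by (intro open_Collect_neq) auto
    moreover have "(\<lambda>x. D x / P x) holomorphic_on N"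
      by (intro holomorphic_intros holomorphic_on_subset[OF D] holomorphic_on_subset[OF P]) (auto simp: N_def)
    then have "g holomorphic_on N"
      by (rule holomorphic_transform) (auto simp: N_def g_def)
    ultimately show ?thesis using False by (auto simp: N_def)
  next
    case True
    \<comment> \<open>Difference quotients completed by the derivative are entire;
      \<open>D1 / P1\<close> agrees with \<open>g\<close> near \<open>a\<close>, and
      \<open>P1 a\<close> is nonzero.\<close>
    define D1 where "D1 x = (if x = a then deriv D a else (D x - D a) / (x - a))" for x
    define P1 where "P1 x = (if x = a then deriv P a else (P x - P a) / (x - a))" for x
    have D1: "D1 holomorphic_on UNIV" and P1: "P1 holomorphic_on UNIV"
      unfolding D1_def P1_def using D P by (auto intro: pole_lemma_open)
    define N where "N = {x. P1 x \<noteq> 0}"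
    have "open N"
      unfolding N_def using holomorphic_on_imp_continuous_on[OF P1]
      by (intro open_Collect_neq) auto
    moreover have "(\<lambda>x. D1 x / P1 x) holomorphic_on N"
      by (intro holomorphic_intros holomorphic_on_subset[OF D1] holomorphic_on_subset[OF P1]) (auto simp: N_def)
    then have "g holomorphic_on N"
      by (rule holomorphic_transform) (use True z(1)[OF True] in \<open>auto simp: N_def g_def D1_def P1_def split: if_splits\<close>)
    moreover have "a \<in> N" using z(2)[OF True] by (simp add: N_def P1_def)
    ultimately show ?thesis by blast
  qed
  then have "g holomorphic_on UNIV"
    by (metis holomorphic_on_imp_differentiable_at holomorphic_on_def field_differentiable_at_within)
  moreover have "D x = g x * P x" for x using z(1)[of x] by (simp add: g_def)
  ultimately show thesis using that by blast
qed

text \<open>All values are taken on a closed period parallelogram, which is compact, so Liouville's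
  theorem applies.\<close>

lemma entire_doubly_periodic_constant:
  fixes g :: "complex \<Rightarrow> complex"
  assumes tau: "Im \<tau> > 0" and g: "g holomorphic_on UNIV"
    and p: "\<And>x. g (x + 1) = g x" "\<And>x. g (x + \<tau>) = g x"
  shows "g x = g y"
proof -
  have p1: "g (x + of_int m) = g x" for x m
  proof (induction m rule: int_induct[where k = 0])
    case (step1 i)
    then show ?case using p(1)[of "x + of_int i"] by (simp add: algebra_simps)
  next
    case (step2 i)
    then show ?case using p(1)[of "x + of_int (i - 1)"] by (simp add: algebra_simps)
  qed simp
  have p2: "g (x + of_int m * \<tau>) = g x" for x m
  proof (induction m rule: int_induct[where k = 0])
    case (step1 i)
    then show ?case using p(2)[of "x + of_int i * \<tau>"] by (simp add: algebra_simps)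
  next
    case (step2 i)
    then show ?case using p(2)[of "x + of_int (i - 1) * \<tau>"] by (simp add: algebra_simps)
  qed simp
  define K where "K = (\<lambda>(s, t). of_real s + of_real t * \<tau>) ` ({0..1::real} \<times> {0..1::real})"
  have "compact K" unfolding K_def
    by (intro compact_continuous_image compact_Times) (auto intro!: continuous_intros simp: case_prod_unfold)
  then have "compact (g ` K)"
    by (intro compact_continuous_image holomorphic_on_imp_continuous_on[OF holomorphic_on_subset[OF g]]) auto
  moreover have "range g \<subseteq> g ` K"
  proof clarify
    fix x
    define t s where "t = Im x / Im \<tau>" and "s = Re x - t * Re \<tau>"
    have x: "x = of_real s + of_real t * \<tau>" using tau by (simp add: complex_eq_iff s_def t_def)
    have "g x = g (of_real (frac s) + of_real (frac t) * \<tau>)"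
      using p1[of "of_real (frac s) + of_real (frac t) * \<tau>" "\<lfloor>s\<rfloor>"]
        p2[of "of_real (frac s) + of_real (frac t) * \<tau> + of_int \<lfloor>s\<rfloor>" "\<lfloor>t\<rfloor>"]
      by (simp add: x frac_def algebra_simps)
    moreover have "of_real (frac s) + of_real (frac t) * \<tau> \<in> K"
      unfolding K_def by (rule image_eqI[of _ _ "(frac s, frac t)"]) (auto simp: frac_lt_1 less_imp_le)
    ultimately show "g x \<in> g ` K" by blast
  qed
  ultimately have "bounded (range g)" using bounded_subset compact_imp_bounded by blast
  from Liouville_theorem[OF g this] show ?thesis by (auto simp: constant_on_def)
qed

section \<open>Weierstrass' three-term identity\<close>

text \<open>The algebra of \<open>F_exchange\<close> with theta values as opaque variables:
  \<open>ab\<close> is theta at a - b, \<open>mn\<close> at m - n, \<open>D\<close> the derivative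
  at 0, \<open>s\<close> the common factor. By \<open>A\<close> and \<open>B\<close> both groups of
  terms equal \<open>- K * Q * R1 * R2 * s\<close>.\<close>

lemma theta_exchange_aux:
  fixes X1 :: complex
  assumes "ab \<noteq> 0" "cd \<noteq> 0" "ac \<noteq> 0" "bd \<noteq> 0" "ad \<noteq> 0" "bc \<noteq> 0" "h \<noteq> 0" "m \<noteq> 0" "n \<noteq> 0" "mn \<noteq> 0"
    and A: "X1 * X2 * X3 * cd - Y3 * Y1 * ab * Y2 = R1 * mn * s * R2"
    and B: "V1 * V2 * ab * bd - W1 * W2 * cd * ac = - (Q * h * bc * s)"
  shows "D * X1 / (- ab * mn) * (D * X2 / (ac * m) * (D * X3 / (bd * n)) * (D * Q / (ad * h)))
     + D * W1 / (ab * h) * (D * R1 / (bc * m) * (D * R2 / (ad * n)) * (D * W2 / (bd * h)))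
     = D * Y1 / (- cd * mn) * (D * Y2 / (ac * n) * (D * Y3 / (bd * m)) * (D * Q / (ad * h)))
     + D * V1 / (cd * h) * (D * R2 / (ad * n) * (D * R1 / (bc * m)) * (D * V2 / (ac * h)))"
proof -
  define K where "K = D ^ 4 / (ab * cd * ac * bd * ad * m * n * h)"
  have 1: "D * X1 / (- ab * mn) * (D * X2 / (ac * m) * (D * X3 / (bd * n)) * (D * Q / (ad * h)))
     - D * Y1 / (- cd * mn) * (D * Y2 / (ac * n) * (D * Y3 / (bd * m)) * (D * Q / (ad * h)))
     = - K * Q / mn * (X1 * X2 * X3 * cd - Y3 * Y1 * ab * Y2)"
    using assms(1-10) by (simp add: K_def divide_simps) algebra
  have 2: "D * V1 / (cd * h) * (D * R2 / (ad * n) * (D * R1 / (bc * m)) * (D * V2 / (ac * h)))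
     - D * W1 / (ab * h) * (D * R1 / (bc * m) * (D * R2 / (ad * n)) * (D * W2 / (bd * h)))
     = K * R1 * R2 / (bc * h) * (V1 * V2 * ab * bd - W1 * W2 * cd * ac)"
    using assms(1-10) by (simp add: K_def divide_simps) algebra
  have "- K * Q / mn * (R1 * mn * s * R2) = K * R1 * R2 / (bc * h) * (- (Q * h * bc * s))"
    using assms(1-10) by (simp add: field_simps)
  then show ?thesis using 1 2 unfolding A B by algebra
qed

context
  fixes \<tau> :: complex
  assumes tau: "Im \<tau> > 0"
begin

section \<open>Entire functions with the quasi-periods of a theta pair\<close>

lemma theta_pair_plus_one:
  "theta \<tau> (x + 1 - s) * theta \<tau> (x + 1 + s) = theta \<tau> (x - s) * theta \<tau> (x + s)"
  using theta_plus_one[of \<tau> "x - s"] theta_plus_one[of \<tau> "x + s"] by (simp add: algebra_simps)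

text \<open>The contributions of \<open>s\<close> to the two multipliers cancel, so all pairs share
  one multiplier.\<close>

lemma theta_pair_plus_tau:
  "theta \<tau> (x + \<tau> - s) * theta \<tau> (x + \<tau> + s) =
    exp (- (2 * of_real pi * \<i> * (\<tau> + 2 * x))) * (theta \<tau> (x - s) * theta \<tau> (x + s))"
proof -
  have e: "exp (- (2 * of_real pi * \<i> * (\<tau> + 2 * x))) =
     (- exp (- (of_real pi * \<i> * \<tau>)) * ex (- (x - s))) * (- exp (- (of_real pi * \<i> * \<tau>)) * ex (- (x + s)))"
    by (simp add: algebra_simps flip: exp_add)
  have "theta \<tau> (x + \<tau> - s) = theta \<tau> (x - s + \<tau>)" "theta \<tau> (x + \<tau> + s) = theta \<tau> (x + s + \<tau>)"
    by (simp_all add: algebra_simps)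
  then show ?thesis
    unfolding e by (simp only: theta_plus_tau[OF tau] mult_ac)
qed

text \<open>The quotient by the theta pair is entire and doubly periodic, hence constant. The
  condition on \<open>2 * w\<close> makes the zeros of the pair simple.\<close>

lemma theta_pair_multiple:
  assumes D: "D holomorphic_on UNIV" and D1: "\<And>x. D (x + 1) = D x"
    and D2: "\<And>x. D (x + \<tau>) = exp (- (2 * of_real pi * \<i> * (\<tau> + 2 * x))) * D x"
    and D0: "D w = 0" "D (- w) = 0" and w: "theta \<tau> (2 * w) \<noteq> 0"
  shows "\<exists>c. \<forall>x. D x = c * (theta \<tau> (x - w) * theta \<tau> (x + w))"
proof -
  define P where "P x = theta \<tau> (x - w) * theta \<tau> (x + w)" for x
  have P: "P holomorphic_on UNIV"
    unfolding P_def by (intro holomorphic_intros holomorphic_on_theta tau)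
  have L: "D (x + of_int m + of_int n * \<tau>) = 0 \<longleftrightarrow> D x = 0" for x m n
  proof -
    have 1: "D (y + of_int m) = 0 \<longleftrightarrow> D y = 0" for y
    proof (induction m rule: int_induct[where k = 0])
      case (step1 i)
      then show ?case using D1[of "y + of_int i"] by (simp add: algebra_simps)
    next
      case (step2 i)
      then show ?case using D1[of "y + of_int (i - 1)"] by (simp add: algebra_simps)
    qed simp
    have 2: "D (y + of_int n * \<tau>) = 0 \<longleftrightarrow> D y = 0" for y
    proof (induction n rule: int_induct[where k = 0])
      case (step1 i)
      then show ?case using D2[of "y + of_int i * \<tau>"] by (simp add: algebra_simps)
    next
      case (step2 i)
      then show ?case using D2[of "y + of_int (i - 1) * \<tau>"] by (simp add: algebra_simps)
    qed simp
    show ?thesis using 1[of x] 2[of "x + of_int m"] by simp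
  qed
  have lat: "\<exists>m n. x = y + of_int m + of_int n * \<tau>" if "theta \<tau> (x - y) = 0" for x y
    using theta_eq_0_imp[OF tau that] by (metis add.assoc diff_add_cancel add.commute)
  \<comment> \<open>A common zero of the two factors would place \<open>2 * w\<close> in the
    lattice.\<close>
  have no_common: False if z: "theta \<tau> (x - w) = 0" "theta \<tau> (x + w) = 0" for x
  proof -
    obtain m n where "x = w + of_int m + of_int n * \<tau>" using lat[OF z(1)] by blast
    then have "x + w = 2 * w + of_int m + of_int n * \<tau>" by simp
    then show False using z(2) w theta_plus_lattice_eq_0_iff[OF tau, of "2 * w" m n]
      by (simp add: add.assoc)
  qed
  have dP: "deriv P x = deriv (theta \<tau>) (x - w) * theta \<tau> (x + w) + deriv (theta \<tau>) (x + w) * theta \<tau> (x - w)" for x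
  proof (rule DERIV_imp_deriv)
    have "((\<lambda>x. theta \<tau> (x - w)) has_field_derivative deriv (theta \<tau>) (x - w)) (at x)"
      using theta_has_derivative[OF tau, of "x + - w"] by (subst (asm) DERIV_shift) simp
    moreover have "((\<lambda>x. theta \<tau> (x + w)) has_field_derivative deriv (theta \<tau>) (x + w)) (at x)"
      using theta_has_derivative[OF tau, of "x + w"] by (subst (asm) DERIV_shift)
    ultimately show "(P has_field_derivative deriv (theta \<tau>) (x - w) * theta \<tau> (x + w)
        + deriv (theta \<tau>) (x + w) * theta \<tau> (x - w)) (at x)"
      unfolding P_def by (auto intro!: derivative_eq_intros)
  qed
  obtain g where g: "g holomorphic_on UNIV" "\<And>x. D x = g x * P x"
  proof (rule entire_quotient[OF D P])
    fix x assume "P x = 0"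
    then consider "theta \<tau> (x - w) = 0" | "theta \<tau> (x - (- w)) = 0" by (auto simp: P_def)
    then show "D x = 0" by cases (use lat L D0 in blast)+
    show "deriv P x \<noteq> 0"
      using \<open>P x = 0\<close> no_common[of x] deriv_theta_nonzero[OF tau] by (auto simp: P_def dP)
  qed (use that in blast)
  \<comment> \<open>If \<open>P\<close> were identically zero, so would be its derivative, which at
    \<open>w\<close> is \<open>deriv (theta \<tau>) 0 * theta \<tau> (2 * w)\<close>.\<close>
  obtain x0 where x0: "P x0 \<noteq> 0"
  proof -
    have "\<exists>x. P x \<noteq> 0"
    proof (rule ccontr)
      assume "\<nexists>x. P x \<noteq> 0"
      then have "P = (\<lambda>_. 0)" by auto
      then have "deriv P w = 0" by simp
      then show False using w deriv_theta_0[OF tau] by (simp add: dP theta_def)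
    qed
    then show thesis using that by blast
  qed
  \<comment> \<open>On \<open>N\<close> the factor \<open>P\<close> cancels and gives periodicity of
    \<open>g\<close>; analytic continuation extends it to the plane.\<close>
  define N where "N = {x. P x \<noteq> 0}"
  have N: "open N" "N \<noteq> {}"
    unfolding N_def using holomorphic_on_imp_continuous_on[OF P] x0
    by (auto intro!: open_Collect_neq)
  have shift: "(\<lambda>x. g (x + a)) holomorphic_on UNIV" for a
    using holomorphic_on_compose_gen[OF _ g(1), of "\<lambda>x. x + a" UNIV]
    by (simp add: o_def holomorphic_on_add holomorphic_on_ident)
  have "g (x + 1) = g x" for x
  proof (rule analytic_continuation_open[OF N(1) open_UNIV N(2) _ _ shift g(1)])
    fix z assume "z \<in> N"
    then show "g (z + 1) = g z"
      using g(2)[of z] g(2)[of "z + 1"] D1[of z] theta_pair_plus_one[of z w] by (auto simp: N_def P_def)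
  qed auto
  moreover have "g (x + \<tau>) = g x" for x
  proof (rule analytic_continuation_open[OF N(1) open_UNIV N(2) _ _ shift g(1)])
    fix z assume "z \<in> N"
    then show "g (z + \<tau>) = g z"
      using g(2)[of z] g(2)[of "z + \<tau>"] D2[of z] theta_pair_plus_tau[of z w] by (auto simp: N_def P_def)
  qed auto
  ultimately have "g x = g 0" for x by (rule entire_doubly_periodic_constant[OF tau g(1)])
  then have "D x = g 0 * P x" for x using g(2)[of x] by metis
  then show ?thesis unfolding P_def by blast
qed

text \<open>As a function of \<open>x\<close>, the difference \<open>E\<close> of the two sides
  vanishes at w and -w, so it is a constant times a theta pair. Its zero at x = y forces the
  constant to be 0 for generic \<open>w\<close>; continuity in \<open>w\<close> does the
  rest.\<close>

lemma theta_three_term: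
  "theta \<tau> (x + z) * theta \<tau> (x - z) * theta \<tau> (y + w) * theta \<tau> (y - w)
   - theta \<tau> (x + w) * theta \<tau> (x - w) * theta \<tau> (y + z) * theta \<tau> (y - z)
   = theta \<tau> (x + y) * theta \<tau> (x - y) * theta \<tau> (z + w) * theta \<tau> (z - w)"
proof -
  define E where "E x w =
    theta \<tau> (x + z) * theta \<tau> (x - z) * theta \<tau> (y + w) * theta \<tau> (y - w)
   - theta \<tau> (x + w) * theta \<tau> (x - w) * theta \<tau> (y + z) * theta \<tau> (y - z)
   - theta \<tau> (x + y) * theta \<tau> (x - y) * theta \<tau> (z + w) * theta \<tau> (z - w)" for x w
  have odd: "theta \<tau> (a - b) = - theta \<tau> (b - a)" for a b
    using theta_minus[of \<tau> "b - a"] by simp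
  have odd': "theta \<tau> (- a - b) = - theta \<tau> (a + b)" "theta \<tau> (- a + b) = - theta \<tau> (a - b)" for a b
    using theta_minus[of \<tau> "a + b"] theta_minus[of \<tau> "a - b"] by (simp_all add: algebra_simps)
  have th0: "theta \<tau> 0 = 0" by (simp add: theta_def)
  \<comment> \<open>The first condition is that of \<open>theta_pair_multiple\<close>; the other two
    keep the pair nonzero at x = y.\<close>
  have generic: "E x w = 0" if w: "theta \<tau> (2 * w) \<noteq> 0" "theta \<tau> (y - w) \<noteq> 0" "theta \<tau> (y + w) \<noteq> 0" for x w
  proof -
    have form: "E x w = theta \<tau> (x - z) * theta \<tau> (x + z) * (theta \<tau> (y + w) * theta \<tau> (y - w))
      - theta \<tau> (x - w) * theta \<tau> (x + w) * (theta \<tau> (y + z) * theta \<tau> (y - z))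
      - theta \<tau> (x - y) * theta \<tau> (x + y) * (theta \<tau> (z + w) * theta \<tau> (z - w))" for x
      by (simp add: E_def mult_ac)
    have "\<exists>c. \<forall>x. E x w = c * (theta \<tau> (x - w) * theta \<tau> (x + w))"
    proof (rule theta_pair_multiple)
      show "(\<lambda>x. E x w) holomorphic_on UNIV"
        unfolding E_def by (intro holomorphic_intros holomorphic_on_theta tau)
      show "E (x + 1) w = E x w" for x by (simp only: form theta_pair_plus_one)
      show "E (x + \<tau>) w = exp (- (2 * of_real pi * \<i> * (\<tau> + 2 * x))) * E x w" for x
        by (simp only: form theta_pair_plus_tau right_diff_distrib mult.assoc)
      show Ew: "E w w = 0"
        using odd[of w z] odd[of w y] by (simp add: E_def th0 add.commute mult_ac)
      have "E (- w) w = E w w" unfolding E_def odd' by (simp add: th0)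
      then show "E (- w) w = 0" using Ew by simp
    qed (rule w(1))
    then obtain c where c: "\<And>x. E x w = c * (theta \<tau> (x - w) * theta \<tau> (x + w))" by blast
    have "E y w = 0" by (simp add: E_def th0)
    with c[of y] w have "c = 0" by simp
    then show ?thesis using c by simp
  qed
  define S where "S = {w. theta \<tau> (2 * w) = 0 \<or> theta \<tau> (y - w) = 0 \<or> theta \<tau> (y + w) = 0}"
  define \<Lambda> where "\<Lambda> = range (\<lambda>(m, n). of_int m + of_int n * \<tau>)"
  have zero: "v \<in> \<Lambda>" if "theta \<tau> v = 0" for v
    using theta_eq_0_imp[OF tau that] by (force simp: \<Lambda>_def)
  have "S \<subseteq> (\<lambda>l. l / 2) ` \<Lambda> \<union> (\<lambda>l. y - l) ` \<Lambda> \<union> (\<lambda>l. l - y) ` \<Lambda>"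
  proof
    fix w assume "w \<in> S"
    then have "2 * w \<in> \<Lambda> \<or> y - w \<in> \<Lambda> \<or> y + w \<in> \<Lambda>"
      by (auto simp: S_def zero)
    then show "w \<in> (\<lambda>l. l / 2) ` \<Lambda> \<union> (\<lambda>l. y - l) ` \<Lambda> \<union> (\<lambda>l. l - y) ` \<Lambda>"
      by (auto intro: image_eqI[of _ _ "2 * w"] image_eqI[of _ _ "y - w"] image_eqI[of _ _ "y + w"])
  qed
  moreover have "countable \<Lambda>" by (simp add: \<Lambda>_def)
  ultimately have "countable S" by (meson countable_Un countable_image countable_subset)
  have "E x w = 0"
  proof (rule continuous_constant_on_closure[of "- S" "\<lambda>w. E x w" 0])
    have "(\<lambda>w. E x w) holomorphic_on UNIV"
      unfolding E_def by (intro holomorphic_intros holomorphic_on_theta tau)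
    then show "continuous_on (closure (- S)) (\<lambda>w. E x w)"
      using continuous_on_subset holomorphic_on_imp_continuous_on by blast
    show "w \<in> closure (- S)" using closure_Compl_countable[OF \<open>countable S\<close>] by simp
  qed (auto simp: S_def intro: generic)
  then show ?thesis by (simp add: E_def)
qed

text \<open>The claim in logarithmic coordinates: \<open>a\<close>, \<open>b\<close>,
  \<open>c\<close>, \<open>d\<close> belong to the four x-variables, \<open>m\<close> and
  \<open>n\<close> to the two \<mu>-variables.\<close>

lemma F_exchange:
  fixes a b c d h m n :: complex
  assumes nz: "theta \<tau> (a - b) \<noteq> 0" "theta \<tau> (c - d) \<noteq> 0" "theta \<tau> (a - c) \<noteq> 0"
    "theta \<tau> (b - d) \<noteq> 0" "theta \<tau> (a - d) \<noteq> 0" "theta \<tau> (b - c) \<noteq> 0"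
    "theta \<tau> h \<noteq> 0" "theta \<tau> m \<noteq> 0" "theta \<tau> n \<noteq> 0" "theta \<tau> (m - n) \<noteq> 0"
  shows "F \<tau> (b - a) (m - n) * (F \<tau> (a - c) m * F \<tau> (b - d) n * F \<tau> (a - d) h)
       + F \<tau> (a - b) h * (F \<tau> (b - c) m * F \<tau> (a - d) n * F \<tau> (b - d) h)
     = F \<tau> (d - c) (m - n) * (F \<tau> (a - c) n * F \<tau> (b - d) m * F \<tau> (a - d) h)
       + F \<tau> (c - d) h * (F \<tau> (a - d) n * F \<tau> (b - c) m * F \<tau> (a - c) h)"
proof -
  have odd: "theta \<tau> (y - x) = - theta \<tau> (x - y)" for x y
    using theta_minus[of \<tau> "x - y"] by simp
  define s where "s = theta \<tau> (b + c - a - d)"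
  have A: "theta \<tau> (b - a + (m - n)) * theta \<tau> (a - c + m) * theta \<tau> (b - d + n) * theta \<tau> (c - d)
     - theta \<tau> (b - d + m) * theta \<tau> (d - c + (m - n)) * theta \<tau> (a - b) * theta \<tau> (a - c + n)
     = theta \<tau> (b - c + m) * theta \<tau> (m - n) * s * theta \<tau> (a - d + n)"
  proof -
    \<comment> \<open>Half sums and half differences of the required arguments. Each of the three
      products gets one negated argument, so the signs cancel.\<close>
    define x z y w where "x = (b - c + 2 * m - n) / 2" and "z = (b - 2 * a + c - n) / 2"
      and "y = (b - c + n) / 2" and "w = (b + c - 2 * d + n) / 2"
    have "x + z = b - a + (m - n)" "x - z = a - c + m" "y + w = b - d + n" "y - w = - (c - d)"
      "x + w = b - d + m" "x - w = d - c + (m - n)" "y + z = - (a - b)" "y - z = a - c + n"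
      "x + y = b - c + m" "x - y = m - n" "z + w = b + c - a - d" "z - w = - (a - d + n)"
      unfolding x_def y_def z_def w_def by (simp_all add: field_simps)
    with theta_three_term[of x z y w] show ?thesis
      by (simp add: s_def theta_minus mult_ac del: minus_diff_eq minus_add_distrib)
        (metis minus_diff_eq minus_minus)
  qed
  have B: "theta \<tau> (c - d + h) * theta \<tau> (a - c + h) * theta \<tau> (a - b) * theta \<tau> (b - d)
     - theta \<tau> (a - b + h) * theta \<tau> (b - d + h) * theta \<tau> (c - d) * theta \<tau> (a - c)
     = - (theta \<tau> (a - d + h) * theta \<tau> h * theta \<tau> (b - c) * s)"
  proof -
    \<comment> \<open>Here only \<open>z + w\<close> comes out negated, which produces the minus
      sign on the right.\<close>
    define x z y w where "x = (a - d) / 2 + h" and "z = c - (a + d) / 2"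
      and "y = (a - d) / 2" and "w = (a + d) / 2 - b"
    have "x + z = c - d + h" "x - z = a - c + h" "y + w = a - b" "y - w = b - d"
      "x + w = a - b + h" "x - w = b - d + h" "y + z = c - d" "y - z = a - c"
      "x + y = a - d + h" "x - y = h" "z + w = - (b - c)" "z - w = b + c - a - d"
      unfolding x_def y_def z_def w_def by (simp_all add: field_simps)
    with theta_three_term[of x z y w] show ?thesis
      by (simp add: s_def theta_minus mult_ac del: minus_diff_eq)
  qed
  show ?thesis
    unfolding F_def odd[of b a] odd[of d c] by (rule theta_exchange_aux[OF nz A B])
qed

text \<open>At m + n \<tau> the logarithm of the modulus is -2 pi n Im \<tau>. Testing moduli alone
  makes the condition continuous and independent of the choice of logarithm.\<close>

lemma theta_nonzero:
  assumes "ln (norm (ex x)) \<notin> range (\<lambda>k::int. (2 * pi * Im \<tau>) *\<^sub>R of_int k)"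
  shows "theta \<tau> x \<noteq> 0"
proof
  assume "theta \<tau> x = 0"
  then obtain m n where "x = of_int m + of_int n * \<tau>" using theta_eq_0_imp[OF tau] by blast
  then have "ln (norm (ex x)) = (2 * pi * Im \<tau>) *\<^sub>R of_int (- n)" by simp
  with assms show False by blast
qed

end

section \<open>Generic points of the torus\<close>

text \<open>By \<open>theta_nonzero\<close>, a point at which none of these functions is a multiple of
  \<open>2 * pi * Im \<tau>\<close> makes all theta factors in the denominators nonzero.\<close>

definition log_moduli :: "(point \<Rightarrow> real) set" where
  "log_moduli = (\<lambda>(i, j) (x, h, \<mu>). ln (norm (x $ i)) - ln (norm (x $ j))) ` {(i, j). i \<noteq> j}
     \<union> {\<lambda>(x, h, \<mu>). ln (norm h)}
     \<union> range (\<lambda>j (x, h, \<mu>). ln (norm (\<mu> $ j)))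
     \<union> {\<lambda>(x, h, \<mu>). ln (norm (\<mu> $ 1)) - ln (norm (\<mu> $ 2))}"

definition generic_points :: "complex \<Rightarrow> point set" where
  "generic_points \<tau> = {p \<in> torus. \<forall>g\<in>log_moduli. g p \<notin> range (\<lambda>k::int. (2 * pi * Im \<tau>) *\<^sub>R of_int k)}"

lemma finite_log_moduli: "finite log_moduli"
  unfolding log_moduli_def by (intro finite_UnI finite_imageI) auto

lemma continuous_on_log_moduli: "g \<in> log_moduli \<Longrightarrow> continuous_on torus g"
  unfolding log_moduli_def torus_def by (auto simp: case_prod_unfold intro!: continuous_intros)

lemma open_torus: "open torus"
proof -
  have "torus = (\<Inter>i. {p. fst p $ i \<noteq> 0}) \<inter> {p. fst (snd p) \<noteq> 0} \<inter> (\<Inter>j. {p. snd (snd p) $ j \<noteq> 0})"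
    by (auto simp: torus_def)
  also have "open \<dots>"
    by (intro open_Int open_INT ballI open_Collect_neq) (auto intro!: continuous_intros)
  finally show ?thesis .
qed

text \<open>The multiples of a fixed real form a closed set, so each of the finitely many conditions
  is open in the torus.\<close>

lemma open_generic_points: "open (generic_points \<tau>)"
proof -
  define L where "L = (*\<^sub>R) (2 * pi * Im \<tau>) ` (\<int> :: real set)"
  have "closed L" unfolding L_def by (intro closed_scaling closed_Ints)
  have "L = range (\<lambda>k::int. (2 * pi * Im \<tau>) *\<^sub>R of_int k)"
    by (auto simp: L_def Ints_def)
  then have "generic_points \<tau> = (\<Inter>g\<in>log_moduli. torus \<inter> g -` (- L)) \<inter> torus"
    unfolding generic_points_def by auto
  also have "open \<dots>"
    using \<open>closed L\<close> finite_log_moduli open_torus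
    by (intro open_Int open_INT ballI continuous_open_preimage continuous_on_log_moduli) auto
  finally show ?thesis .
qed

text \<open>Multiplying the coordinates by \<open>exp (t * e)\<close> with exponents \<open>e\<close> that are distinct and
  nonzero changes each function in \<^const>\<open>log_moduli\<close> at a constant nonzero rate, so that only
  countably many \<open>t\<close> give a point that is not generic.\<close>

lemma torus_subset_closure_generic_points: "torus \<subseteq> closure (generic_points \<tau>)"
proof
  fix p assume p: "p \<in> torus"
  obtain x h \<mu> where pe: "p = (x, h, \<mu>)" by (cases p) auto
  have nz: "x $ i \<noteq> 0" "h \<noteq> 0" "\<mu> $ j \<noteq> 0" for i j
    using p by (auto simp: torus_def pe)
  define e :: "4 \<Rightarrow> real" where "e i = real (to_nat i)" for i
  \<comment> \<open>\<open>Suc\<close> matters because single moduli of \<open>\<mu> $ j\<close>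
    occur in \<open>log_moduli\<close>; the coordinates of \<open>x\<close> enter only through
    differences, for which distinct exponents suffice.\<close>
  define e' :: "2 \<Rightarrow> real" where "e' i = real (Suc (to_nat i))" for i
  define \<gamma> :: "real \<Rightarrow> point" where "\<gamma> t = (\<chi> i. of_real (exp (t * e i)) * x $ i, of_real (exp t) * h,
    \<chi> j. of_real (exp (t * e' j)) * \<mu> $ j)" for t
  define L where "L = range (\<lambda>k::int. (2 * pi * Im \<tau>) *\<^sub>R of_int k :: real)"
  have "\<exists>\<kappa>. \<kappa> \<noteq> 0 \<and> (\<forall>t. g (\<gamma> t) = g p + t * \<kappa>)" if "g \<in> log_moduli" for g
  proof -
    have "\<exists>\<kappa>. \<kappa> \<noteq> 0 \<and> (\<forall>t. (\<lambda>(x, h, \<mu>). ln (norm (x $ i)) - ln (norm (x $ j))) (\<gamma> t)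
        = (\<lambda>(x, h, \<mu>). ln (norm (x $ i)) - ln (norm (x $ j))) p + t * \<kappa>)" if "i \<noteq> j" for i j
      using that nz by (intro exI[of _ "e i - e j"])
        (auto simp: \<gamma>_def pe e_def norm_mult ln_mult algebra_simps)
    moreover have "\<exists>\<kappa>. \<kappa> \<noteq> 0 \<and> (\<forall>t. (\<lambda>(x, h, \<mu>). ln (norm h)) (\<gamma> t)
        = (\<lambda>(x, h, \<mu>). ln (norm h)) p + t * \<kappa>)"
      using nz by (intro exI[of _ 1]) (auto simp: \<gamma>_def pe norm_mult ln_mult)
    moreover have "\<exists>\<kappa>. \<kappa> \<noteq> 0 \<and> (\<forall>t. (\<lambda>(x, h, \<mu>). ln (norm (\<mu> $ j))) (\<gamma> t)
        = (\<lambda>(x, h, \<mu>). ln (norm (\<mu> $ j))) p + t * \<kappa>)" for j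
      using nz by (intro exI[of _ "e' j"])
        (auto simp: \<gamma>_def pe e'_def norm_mult ln_mult simp del: of_nat_Suc)
    moreover have "\<exists>\<kappa>. \<kappa> \<noteq> 0 \<and> (\<forall>t. (\<lambda>(x, h, \<mu>). ln (norm (\<mu> $ 1)) - ln (norm (\<mu> $ 2))) (\<gamma> t)
        = (\<lambda>(x, h, \<mu>). ln (norm (\<mu> $ 1)) - ln (norm (\<mu> $ 2))) p + t * \<kappa>)"
      using nz by (intro exI[of _ "e' 1 - e' 2"])
        (auto simp: \<gamma>_def pe e'_def norm_mult ln_mult algebra_simps)
    ultimately show ?thesis using that unfolding log_moduli_def by auto
  qed
  then obtain \<kappa> where \<kappa>: "\<And>g. g \<in> log_moduli \<Longrightarrow> \<kappa> g \<noteq> 0"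
      "\<And>g t. g \<in> log_moduli \<Longrightarrow> g (\<gamma> t) = g p + t * \<kappa> g" by metis
  define B where "B = (\<Union>g\<in>log_moduli. (\<lambda>l. (l - g p) / \<kappa> g) ` L)"
  have "countable B" unfolding B_def L_def
    using countable_finite[OF finite_log_moduli] by auto
  then have "0 \<in> closure (- B)" by (simp add: closure_Compl_countable)
  have "\<gamma> t \<in> generic_points \<tau>" if "t \<notin> B" for t
  proof -
    have "g (\<gamma> t) \<notin> L" if g: "g \<in> log_moduli" for g
    proof
      assume "g (\<gamma> t) \<in> L"
      moreover have "t = (g (\<gamma> t) - g p) / \<kappa> g" using \<kappa>[OF g] by simp
      ultimately have "t \<in> B" using g unfolding B_def by blast
      with \<open>t \<notin> B\<close> show False ..
    qed
    moreover have "\<gamma> t \<in> torus" using nz by (auto simp: torus_def \<gamma>_def)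
    ultimately show ?thesis by (auto simp: generic_points_def L_def)
  qed
  \<comment> \<open>The parameter 0, where the curve passes through \<open>p\<close>, is a limit of
    parameters outside \<open>B\<close>.\<close>
  then have "\<gamma> ` closure (- B) \<subseteq> closure (generic_points \<tau>)"
    using closure_subset[of "generic_points \<tau>"]
    by (intro image_closure_subset) (auto simp: \<gamma>_def intro!: continuous_intros)
  moreover have "\<gamma> 0 = p" by (simp add: \<gamma>_def pe vec_eq_iff)
  ultimately show "p \<in> closure (generic_points \<tau>)" using \<open>0 \<in> closure (- B)\<close> by blast
qed

section \<open>Evaluation of both sides at generic points\<close>

lemma delta_exp_diff:
  "delta \<tau> (ex a / ex b) (ex c) = F \<tau> (a - b) c"
  "delta \<tau> (ex a / ex b) (ex c / ex d) = F \<tau> (a - b) (c - d)"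
  using delta_exp[of \<tau> "a - b" c] delta_exp[of \<tau> "a - b" "c - d"]
  by (simp_all add: right_diff_distrib exp_diff)

text \<open>Logarithmic coordinates turn the two sides into those of \<open>F_exchange\<close>;
  genericity supplies its nonvanishing conditions.\<close>

lemma C_op_generic:
  assumes tau: "Im \<tau> > 0" and p: "p \<in> generic_points \<tau>"
  shows "C_op \<tau> 1 (\<lambda>\<mu>. \<mu> $ 1 / \<mu> $ 2) (A_fun \<tau>) p
    = swap_mu (C_op \<tau> 3 (\<lambda>\<mu>. \<mu> $ 2 / \<mu> $ 1) (A_fun \<tau>)) p"
proof -
  obtain x h \<mu> where pe: "p = (x, h, \<mu>)" by (cases p) auto
  have nz: "x $ i \<noteq> 0" "h \<noteq> 0" "\<mu> $ j \<noteq> 0" for i j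
    using p by (auto simp: generic_points_def torus_def pe)
  define lg where "lg z = Ln z / (2 * of_real pi * \<i>)" for z
  have lg: "ex (lg z) = z" if "z \<noteq> 0" for z using that by (simp add: lg_def)
  define \<xi> where "\<xi> i = lg (x $ i)" for i
  define \<eta> where "\<eta> = lg h"
  define \<zeta> where "\<zeta> j = lg (\<mu> $ j)" for j
  have e: "x $ i = ex (\<xi> i)" "h = ex \<eta>" "\<mu> $ j = ex (\<zeta> j)" for i j
    using nz by (simp_all add: \<xi>_def \<eta>_def \<zeta>_def lg)
  have ed: "ln (norm (ex (a - b))) = ln (norm (ex a)) - ln (norm (ex b))" for a b
    by (simp add: right_diff_distrib)
  have g: "g p \<notin> range (\<lambda>k::int. (2 * pi * Im \<tau>) *\<^sub>R of_int k)" if "g \<in> log_moduli" for g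
    using p that by (auto simp: generic_points_def)
  have t1: "theta \<tau> (\<xi> i - \<xi> j) \<noteq> 0" if "i \<noteq> j" for i j
  proof (rule theta_nonzero[OF tau])
    have "(\<lambda>(x, h, \<mu>). ln (norm (x $ i)) - ln (norm (x $ j))) \<in> log_moduli"
      using that unfolding log_moduli_def by force
    from g[OF this] show "ln (norm (ex (\<xi> i - \<xi> j))) \<notin> range (\<lambda>k::int. (2 * pi * Im \<tau>) *\<^sub>R of_int k)"
      unfolding ed pe e[symmetric] by simp
  qed
  have t2: "theta \<tau> \<eta> \<noteq> 0"
  proof (rule theta_nonzero[OF tau])
    have "(\<lambda>(x, h, \<mu>). ln (norm h)) \<in> log_moduli"
      unfolding log_moduli_def by force
    from g[OF this] show "ln (norm (ex \<eta>)) \<notin> range (\<lambda>k::int. (2 * pi * Im \<tau>) *\<^sub>R of_int k)"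
      unfolding pe e[symmetric] by simp
  qed
  have t3: "theta \<tau> (\<zeta> j) \<noteq> 0" for j
  proof (rule theta_nonzero[OF tau])
    have "(\<lambda>(x, h, \<mu>). ln (norm (\<mu> $ j))) \<in> log_moduli"
      unfolding log_moduli_def by force
    from g[OF this] show "ln (norm (ex (\<zeta> j))) \<notin> range (\<lambda>k::int. (2 * pi * Im \<tau>) *\<^sub>R of_int k)"
      unfolding pe e[symmetric] by simp
  qed
  have t4: "theta \<tau> (\<zeta> 1 - \<zeta> 2) \<noteq> 0"
  proof (rule theta_nonzero[OF tau])
    have "(\<lambda>(x, h, \<mu>). ln (norm (\<mu> $ 1)) - ln (norm (\<mu> $ 2))) \<in> log_moduli"
      unfolding log_moduli_def by force
    from g[OF this] show "ln (norm (ex (\<zeta> 1 - \<zeta> 2))) \<notin> range (\<lambda>k::int. (2 * pi * Im \<tau>) *\<^sub>R of_int k)"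
      unfolding ed pe e[symmetric] by simp
  qed
  have four: "(1::4) \<noteq> 2" "(1::4) \<noteq> 3" "(1::4) \<noteq> 4" "(2::4) \<noteq> 3" "(2::4) \<noteq> 4" "(3::4) \<noteq> 4"
    "(3::4) + 1 = 4" "(1::4) + 1 = 2" by simp_all
  have perm: "Transposition.transpose 1 2 (1::4) = 2" "Transposition.transpose 1 2 (2::4) = 1"
    "Transposition.transpose 1 2 (3::4) = 3" "Transposition.transpose 1 2 (4::4) = 4"
    "Transposition.transpose 3 4 (1::4) = 1" "Transposition.transpose 3 4 (2::4) = 2"
    "Transposition.transpose 3 4 (3::4) = 4" "Transposition.transpose 3 4 (4::4) = 3"
    "Transposition.transpose 1 2 (1::2) = 2" "Transposition.transpose 1 2 (2::2) = 1"
    by (simp_all add: Transposition.transpose_def)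
  have "C_op \<tau> 1 (\<lambda>\<mu>. \<mu> $ 1 / \<mu> $ 2) (A_fun \<tau>) p =
    F \<tau> (\<xi> 2 - \<xi> 1) (\<zeta> 1 - \<zeta> 2) * (F \<tau> (\<xi> 1 - \<xi> 3) (\<zeta> 1) * F \<tau> (\<xi> 2 - \<xi> 4) (\<zeta> 2) * F \<tau> (\<xi> 1 - \<xi> 4) \<eta>)
    + F \<tau> (\<xi> 1 - \<xi> 2) \<eta> * (F \<tau> (\<xi> 2 - \<xi> 3) (\<zeta> 1) * F \<tau> (\<xi> 1 - \<xi> 4) (\<zeta> 2) * F \<tau> (\<xi> 2 - \<xi> 4) \<eta>)"
    unfolding C_op_def swap_x_def A_fun_def pe prod.case four(7-8) vec_lambda_beta
    by (simp only: perm e delta_exp_diff)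
  also have "\<dots> = F \<tau> (\<xi> 4 - \<xi> 3) (\<zeta> 1 - \<zeta> 2) * (F \<tau> (\<xi> 1 - \<xi> 3) (\<zeta> 2) * F \<tau> (\<xi> 2 - \<xi> 4) (\<zeta> 1) * F \<tau> (\<xi> 1 - \<xi> 4) \<eta>)
    + F \<tau> (\<xi> 3 - \<xi> 4) \<eta> * (F \<tau> (\<xi> 1 - \<xi> 4) (\<zeta> 2) * F \<tau> (\<xi> 2 - \<xi> 3) (\<zeta> 1) * F \<tau> (\<xi> 1 - \<xi> 3) \<eta>)"
    by (rule F_exchange[OF tau]) (intro t1 t2 t3 t4 four)+
  \<comment> \<open>The swap acts on the parameter too: the ratio of \<mu>-variables becomes
    \<open>\<zeta> 1 - \<zeta> 2\<close>, as on the left.\<close>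
  also have "\<dots> = swap_mu (C_op \<tau> 3 (\<lambda>\<mu>. \<mu> $ 2 / \<mu> $ 1) (A_fun \<tau>)) p"
    unfolding C_op_def swap_x_def swap_mu_def A_fun_def pe prod.case four(7-8) vec_lambda_beta
    by (simp only: perm e delta_exp_diff)
  finally show ?thesis .
qed

lemma mero_eqI_generic_points:
  "(\<And>p. p \<in> generic_points \<tau> \<Longrightarrow> f p = g p) \<Longrightarrow> mero_eq f g"
  unfolding mero_eq_def using open_generic_points torus_subset_closure_generic_points
  by (intro exI[of _ "generic_points \<tau>"]) (auto simp: generic_points_def)

theorem corollary16p1:
  fixes \<tau> :: complex
  assumes "Im \<tau> > 0"
  shows "mero_eq (C_op \<tau> 1 (\<lambda>\<mu>. \<mu> $ 1 / \<mu> $ 2) (A_fun \<tau>))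
                 (swap_mu (C_op \<tau> 3 (\<lambda>\<mu>. \<mu> $ 2 / \<mu> $ 1) (A_fun \<tau>)))
       \<and> mero_eq (C_red \<tau> 1 (\<lambda>\<mu>. \<mu> $ 1 / \<mu> $ 2) (A_fun \<tau>))
                 (swap_mu (C_red \<tau> 3 (\<lambda>\<mu>. \<mu> $ 2 / \<mu> $ 1) (A_fun \<tau>)))"
proof (intro conjI mero_eqI_generic_points[where \<tau> = \<tau>])
  fix p assume p: "p \<in> generic_points \<tau>"
  show "C_op \<tau> 1 (\<lambda>\<mu>. \<mu> $ 1 / \<mu> $ 2) (A_fun \<tau>) p
    = swap_mu (C_op \<tau> 3 (\<lambda>\<mu>. \<mu> $ 2 / \<mu> $ 1) (A_fun \<tau>)) p"
    by (rule C_op_generic[OF assms p])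
  \<comment> \<open>Zeros of the prefactor's \<open>delta\<close> are harmless: after the swap both
    sides carry the same value of \<open>1 / delta\<close>, even when it is 1 / 0 = 0.\<close>
  then show "C_red \<tau> 1 (\<lambda>\<mu>. \<mu> $ 1 / \<mu> $ 2) (A_fun \<tau>) p
    = swap_mu (C_red \<tau> 3 (\<lambda>\<mu>. \<mu> $ 2 / \<mu> $ 1) (A_fun \<tau>)) p"
    by (simp add: C_red_def swap_mu_def split: prod.splits)
qed

end
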